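(* For every constant positive integer $k$ there are infinitely many $n$ for which there exists a $k$-th order sensitive Boolean function $f$ on $n$ variables with $\mathrm{pdeg}(f)=n^{\frac{\log k}{\log (k+1)}}$ if $k$ is even, and $\mathrm{pdeg}(f)=n^{\frac{\log(k+1)}{\log(k+2)}}$ if $k$ is odd.
   Context: $\mathrm{pdeg}$ is the real polynomial degree (degree of the unique multilinear real polynomial agreeing with $f$ on the Boolean cube). For $S\subseteq[n]$, $\mathbf{x}^{(S)}$ is $\mathbf{x}$ with the bits in $S$ flipped; $f$ is $k$-th order sensitive if there is $\mathbf{x}$ with $f(\mathbf{x})\ne f(\mathbf{x}^{(S)})$ for all $S$ with $1\le|S|\le k$. *)

theory Defs
  imports Complex_Main "HOL-Library.FuncSet"
begin

text \<open>
  A Boolean function on \<open>n\<close> variables is a map on \<open>cube n\<close>, the points of which are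
  undefined outside \<open>{1..n}\<close>; it is given as a total function \<open>f\<close> on \<open>nat \<Rightarrow> bool\<close> whose
  values off \<open>cube n\<close> are never inspected.
\<close>

definition cube :: "nat \<Rightarrow> (nat \<Rightarrow> bool) set" where
  "cube n = {1..n} \<rightarrow>\<^sub>E (UNIV :: bool set)"

definition flip :: "nat set \<Rightarrow> (nat \<Rightarrow> bool) \<Rightarrow> (nat \<Rightarrow> bool)" where
  "flip S x = (\<lambda>i. if i \<in> S then \<not> x i else x i)"

definition order_sensitive :: "nat \<Rightarrow> nat \<Rightarrow> ((nat \<Rightarrow> bool) \<Rightarrow> bool) \<Rightarrow> bool" where
  "order_sensitive k n f \<longleftrightarrow>
     (\<exists>x \<in> cube n. \<forall>S. S \<subseteq> {1..n} \<and> 1 \<le> card S \<and> card S \<le> k \<longrightarrow> f x \<noteq> f (flip S x))"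

text \<open>
  A multilinear real polynomial in \<open>x\<^sub>1, \<dots>, x\<^sub>n\<close> is given by its coefficients: \<open>c S\<close> is the
  coefficient of the monomial \<open>\<Prod>i\<in>S. x\<^sub>i\<close>. The zero polynomial gets degree \<open>0\<close>.
\<close>

definition multilinear :: "nat \<Rightarrow> (nat set \<Rightarrow> real) \<Rightarrow> bool" where
  "multilinear n c \<longleftrightarrow> (\<forall>S. c S \<noteq> 0 \<longrightarrow> S \<subseteq> {1..n})"

definition ml_eval :: "nat \<Rightarrow> (nat set \<Rightarrow> real) \<Rightarrow> (nat \<Rightarrow> real) \<Rightarrow> real" where
  "ml_eval n c y = (\<Sum>S \<in> Pow {1..n}. c S * (\<Prod>i\<in>S. y i))"

definition ml_degree :: "(nat set \<Rightarrow> real) \<Rightarrow> nat" where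
  "ml_degree c = Max (insert 0 (card ` {S. c S \<noteq> 0}))"

definition represents :: "nat \<Rightarrow> (nat set \<Rightarrow> real) \<Rightarrow> ((nat \<Rightarrow> bool) \<Rightarrow> bool) \<Rightarrow> bool" where
  "represents n c f \<longleftrightarrow> multilinear n c \<and>
     (\<forall>x \<in> cube n. ml_eval n c (\<lambda>i. of_bool (x i)) = of_bool (f x))"

definition pdeg :: "nat \<Rightarrow> ((nat \<Rightarrow> bool) \<Rightarrow> bool) \<Rightarrow> nat" where
  "pdeg n f = ml_degree (THE c. represents n c f)"

text \<open>The description in \<open>pdeg\<close> is proper: the representing polynomial exists and is unique.\<close>

lemma subset_sums_exist:
  fixes g :: "'a set \<Rightarrow> real"
  assumes "finite A"
  shows "\<exists>c. (\<forall>S. c S \<noteq> 0 \<longrightarrow> S \<subseteq> A) \<and> (\<forall>T. T \<subseteq> A \<longrightarrow> (\<Sum>S\<in>Pow T. c S) = g T)"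
  using assms
proof (induction A arbitrary: g rule: finite_induct)
  case empty
  show ?case by (rule exI[of _ "\<lambda>S. if S = {} then g {} else 0"]) auto
next
  case (insert a A)
  obtain c where c: "\<And>S. c S \<noteq> 0 \<Longrightarrow> S \<subseteq> A" "\<And>T. T \<subseteq> A \<Longrightarrow> (\<Sum>S\<in>Pow T. c S) = g T"
    using insert.IH[of g] by blast
  obtain c' where c': "\<And>S. c' S \<noteq> 0 \<Longrightarrow> S \<subseteq> A"
    "\<And>T. T \<subseteq> A \<Longrightarrow> (\<Sum>S\<in>Pow T. c' S) = g (insert a T) - g T"
    using insert.IH[of "\<lambda>T. g (insert a T) - g T"] by blast
  define d where "d = (\<lambda>S. if a \<in> S then c' (S - {a}) else c S)"
  have old: "(\<Sum>S\<in>Pow T. d S) = g T" if "T \<subseteq> A" for T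
  proof -
    have "(\<Sum>S\<in>Pow T. d S) = (\<Sum>S\<in>Pow T. c S)"
      using that insert.hyps by (intro sum.cong) (auto simp: d_def)
    then show ?thesis using c(2)[OF that] by simp
  qed
  have new: "(\<Sum>S\<in>Pow (insert a T). d S) = g (insert a T)" if T: "T \<subseteq> A" for T
  proof -
    have fin: "finite (Pow T)" using T insert.hyps(1) by (simp add: finite_subset)
    have aT: "a \<notin> T" using T insert.hyps by auto
    have inj: "inj_on (insert a) (Pow T)"
      proof (rule inj_onI)
      fix U V assume "U \<in> Pow T" "V \<in> Pow T" and eq: "insert a U = insert a V"
      then have "a \<notin> U" "a \<notin> V" using aT by blast+
      then show "U = V" using eq by (simp add: insert_ident)
    qed
    have "(\<Sum>S\<in>Pow (insert a T). d S) = (\<Sum>S\<in>Pow T. d S) + (\<Sum>S\<in>insert a ` Pow T. d S)"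
      unfolding Pow_insert using fin aT by (intro sum.union_disjoint) auto
    also have "(\<Sum>S\<in>insert a ` Pow T. d S) = (\<Sum>S\<in>Pow T. d (insert a S))"
      using sum.reindex[OF inj] by simp
    also have "\<dots> = (\<Sum>S\<in>Pow T. c' S)"
    proof (intro sum.cong refl)
      fix S assume "S \<in> Pow T"
      then have "insert a S - {a} = S" using aT by auto
      then show "d (insert a S) = c' S" by (simp add: d_def)
    qed
    finally show ?thesis using old[OF T] c'(2)[OF T] by simp
  qed
  show ?case
  proof (intro exI[of _ d] conjI allI impI)
    fix S assume "d S \<noteq> 0"
    then show "S \<subseteq> insert a A"
      using c(1)[of S] c'(1)[of "S - {a}"] by (auto simp: d_def split: if_splits)
  next
    fix T assume T: "T \<subseteq> insert a A"
    show "(\<Sum>S\<in>Pow T. d S) = g T"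
    proof (cases "a \<in> T")
      case True
      have "insert a (T - {a}) = T" using True by auto
      then show ?thesis using new[of "T - {a}"] T by auto
    next
      case False
      then show ?thesis using old[of T] T by auto
    qed
  qed
qed

lemma subset_sums_zero:
  fixes d :: "'a set \<Rightarrow> real"
  assumes "finite T" and "\<And>U. U \<subseteq> T \<Longrightarrow> (\<Sum>S\<in>Pow U. d S) = 0"
  shows "d T = 0"
  using assms
proof (induction T rule: finite_psubset_induct)
  case (psubset T)
  have "(\<Sum>S\<in>Pow T. d S) = d T + (\<Sum>S\<in>Pow T - {T}. d S)"
    using psubset.hyps by (intro sum.remove) auto
  moreover have "(\<Sum>S\<in>Pow T - {T}. d S) = 0"
  proof (intro sum.neutral ballI)
    fix S assume "S \<in> Pow T - {T}"
    then have "S \<subset> T" by auto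
    then show "d S = 0" using psubset.IH[of S] psubset.prems by auto
  qed
  ultimately show ?case using psubset.prems[of T] by simp
qed

lemma ml_eval_of_bool:
  "ml_eval n c (\<lambda>i. of_bool (x i)) = (\<Sum>S \<in> Pow {i \<in> {1..n}. x i}. c S)"
proof -
  have "ml_eval n c (\<lambda>i. of_bool (x i)) =
      (\<Sum>S \<in> Pow {1..n}. if S \<in> Pow {i \<in> {1..n}. x i} then c S else 0)"
    unfolding ml_eval_def
  proof (intro sum.cong refl)
    fix S assume S: "S \<in> Pow {1..n}"
    then have fS: "finite S" by (auto intro: finite_subset)
    show "c S * (\<Prod>i\<in>S. of_bool (x i)) = (if S \<in> Pow {i \<in> {1..n}. x i} then c S else 0)"
    proof (cases "\<forall>i\<in>S. x i")
      case True
      then show ?thesis using S by auto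
    next
      case False
      then obtain i where i: "i \<in> S" "\<not> x i" by auto
      have "(\<Prod>i\<in>S. of_bool (x i) :: real) = 0" using fS i by (intro prod_zero) auto
      then show ?thesis using i by auto
    qed
  qed
  also have "\<dots> = (\<Sum>S \<in> Pow {1..n} \<inter> Pow {i \<in> {1..n}. x i}. c S)"
    by (subst sum.inter_restrict) auto
  also have "Pow {1..n} \<inter> Pow {i \<in> {1..n}. x i} = Pow {i \<in> {1..n}. x i}" by auto
  finally show ?thesis .
qed

lemma represents_iff:
  "represents n c f \<longleftrightarrow> (\<forall>S. c S \<noteq> 0 \<longrightarrow> S \<subseteq> {1..n}) \<and>
     (\<forall>T. T \<subseteq> {1..n} \<longrightarrow>
        (\<Sum>S\<in>Pow T. c S) = of_bool (f (restrict (\<lambda>i. i \<in> T) {1..n})))"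
proof -
  have "(\<forall>x \<in> cube n. (\<Sum>S \<in> Pow {i \<in> {1..n}. x i}. c S) = of_bool (f x)) \<longleftrightarrow>
      (\<forall>T. T \<subseteq> {1..n} \<longrightarrow>
        (\<Sum>S\<in>Pow T. c S) = of_bool (f (restrict (\<lambda>i. i \<in> T) {1..n})))" (is "?L = ?R")
  proof
    assume L: ?L
    show ?R
    proof (intro allI impI)
      fix T :: "nat set" assume T: "T \<subseteq> {1..n}"
      let ?x = "restrict (\<lambda>i. i \<in> T) {1..n}"
      have "?x \<in> cube n" by (simp add: cube_def)
      moreover have "{i \<in> {1..n}. ?x i} = T" using T by auto
      ultimately show "(\<Sum>S\<in>Pow T. c S) = of_bool (f ?x)" using L by metis
    qed
  next
    assume R: ?R
    show ?L
    proof
      fix x assume x: "x \<in> cube n"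
      let ?T = "{i \<in> {1..n}. x i}"
      have "restrict (\<lambda>i. i \<in> ?T) {1..n} = x"
        using x by (auto simp: cube_def PiE_def extensional_def restrict_def)
      moreover have "?T \<subseteq> {1..n}" by auto
      ultimately show "(\<Sum>S\<in>Pow ?T. c S) = of_bool (f x)" using R by metis
    qed
  qed
  then show ?thesis
    unfolding represents_def multilinear_def by (simp only: ml_eval_of_bool)
qed

lemma represents_ex1: "\<exists>!c. represents n c f"
proof (rule ex_ex1I)
  show "\<exists>c. represents n c f"
    unfolding represents_iff by (rule subset_sums_exist) simp
next
  fix c c' assume c: "represents n c f" and c': "represents n c' f"
  show "c = c'"
  proof
    fix T
    show "c T = c' T"
    proof (cases "T \<subseteq> {1..n}")
      case True
      have "c T - c' T = 0"
      proof (rule subset_sums_zero[of T "\<lambda>S. c S - c' S"])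
        show "finite T" using True by (rule finite_subset) simp
        show "(\<Sum>S\<in>Pow U. c S - c' S) = 0" if "U \<subseteq> T" for U
        proof -
          have "U \<subseteq> {1..n}" using that True by blast
          then show ?thesis
            using c c' unfolding represents_iff by (simp add: sum_subtractf)
        qed
      qed
      then show ?thesis by simp
    next
      case False
      then show ?thesis using c c' unfolding represents_iff by metis
    qed
  qed
qed

end

theory Submission
  imports Defs "HOL-Library.Disjoint_Sets" "HOL-Computational_Algebra.Polynomial"
begin

text \<open>
  For even \<open>K\<close> the not-all-equal function on \<open>K + 1\<close> bits is \<open>K\<close>-th order sensitive at the
  origin, and its polynomial \<open>1 - \<Prod>y\<^sub>i - \<Prod>(1 - y\<^sub>i)\<close> has degree only \<open>K\<close>, because the
  two top monomials cancel for an odd number of variables. Composing it \<open>m\<close> times with itself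
  gives a function on \<open>(K + 1)\<^sup>m\<close> bits which is still sensitive at the origin, as flipping at most
  \<open>K\<close> bits leaves one of the \<open>K + 1\<close> blocks untouched. Its degree is at most \<open>K\<^sup>m\<close>, and exactly
  that because its restriction to the diagonal is the \<open>m\<close>-th iterate of the univariate polynomial
  \<open>1 - X\<^bsup>K+1\<^esup> - (1 - X)\<^bsup>K+1\<^esup>\<close>. For odd \<open>k\<close> take \<open>K = k + 1\<close>.
\<close>

section \<open>Functions given by multilinear polynomials of bounded degree\<close>

inductive multilinear_fun :: "nat set \<Rightarrow> nat \<Rightarrow> ((nat \<Rightarrow> real) \<Rightarrow> real) \<Rightarrow> bool"
  for A d where
  zero: "multilinear_fun A d (\<lambda>_. 0)"
| add_monomial: "S \<subseteq> A \<Longrightarrow> card S \<le> d \<Longrightarrow> multilinear_fun A d F \<Longrightarrow>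
    multilinear_fun A d (\<lambda>y. a * (\<Prod>i\<in>S. y i) + F y)"

lemma multilinear_fun_monomial:
  "S \<subseteq> A \<Longrightarrow> card S \<le> d \<Longrightarrow> multilinear_fun A d (\<lambda>y. a * (\<Prod>i\<in>S. y i))"
  using multilinear_fun.add_monomial[OF _ _ multilinear_fun.zero] by simp

lemma multilinear_fun_mono:
  assumes "multilinear_fun A d F" "A \<subseteq> B" "d \<le> e"
  shows "multilinear_fun B e F"
  using assms(1) by induction (use assms(2,3) in \<open>auto intro!: multilinear_fun.intros\<close>)

lemma multilinear_fun_add:
  assumes "multilinear_fun A d F" "multilinear_fun A d G"
  shows "multilinear_fun A d (\<lambda>y. F y + G y)"
  using assms(1)
proof induction
  case (add_monomial S F a)
  then show ?case
    using multilinear_fun.add_monomial[of S A d "\<lambda>y. F y + G y" a] by (simp add: add.assoc)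
qed (use assms(2) in simp)

lemma multilinear_fun_scale:
  assumes "multilinear_fun A d F"
  shows "multilinear_fun A d (\<lambda>y. b * F y)"
  using assms
proof induction
  case (add_monomial S F a)
  then show ?case
    using multilinear_fun.add_monomial[of S A d "\<lambda>y. b * F y" "b * a"]
    by (simp add: distrib_left mult.assoc)
qed (simp add: multilinear_fun.zero)

lemma multilinear_fun_sum:
  assumes "\<And>j. j \<in> J \<Longrightarrow> multilinear_fun A d (F j)"
  shows "multilinear_fun A d (\<lambda>y. \<Sum>j\<in>J. F j y)"
  using assms
  by (induction J rule: infinite_finite_induct)
    (auto intro: multilinear_fun.zero multilinear_fun_add)

text \<open>Disjointness of \<open>A\<close> and \<open>B\<close> keeps the product multilinear: no
  variable is squared, and the sizes of the index sets add. The nested inductions multiply out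
  monomial by monomial.\<close>

lemma multilinear_fun_mult:
  assumes "finite A" "finite B" "A \<inter> B = {}" "multilinear_fun A d F" "multilinear_fun B e G"
  shows "multilinear_fun (A \<union> B) (d + e) (\<lambda>y. F y * G y)"
  using assms(4)
proof induction
  case zero
  then show ?case by (simp add: multilinear_fun.zero)
next
  case (add_monomial S F a)
  have "multilinear_fun (A \<union> B) (d + e) (\<lambda>y. (a * (\<Prod>i\<in>S. y i)) * G y)"
    using assms(5)
  proof induction
    case zero
    then show ?case by (simp add: multilinear_fun.zero)
  next
    case (add_monomial T G b)
    have "finite S" "finite T" "S \<inter> T = {}"
      using \<open>S \<subseteq> A\<close> \<open>T \<subseteq> B\<close> assms(1-3) by (auto intro: finite_subset)
    then have *: "card (S \<union> T) = card S + card T"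
      "\<And>y :: nat \<Rightarrow> real. (\<Prod>i\<in>S \<union> T. y i) = (\<Prod>i\<in>S. y i) * (\<Prod>i\<in>T. y i)"
      by (simp_all add: card_Un_disjoint prod.union_disjoint)
    have "multilinear_fun (A \<union> B) (d + e)
        (\<lambda>y. (a * b) * (\<Prod>i\<in>S \<union> T. y i) + (a * (\<Prod>i\<in>S. y i)) * G y)"
      using add_monomial \<open>S \<subseteq> A\<close> \<open>card S \<le> d\<close>
      by (intro multilinear_fun.add_monomial) (auto simp: *)
    then show ?case by (simp add: * algebra_simps)
  qed
  from multilinear_fun_add[OF this add_monomial.IH]
  show ?case by (simp add: algebra_simps)
qed

lemma multilinear_fun_prod:
  assumes "finite J" "disjoint_family_on A J"
    and "\<And>j. j \<in> J \<Longrightarrow> finite (A j)" "\<And>j. j \<in> J \<Longrightarrow> multilinear_fun (A j) d (F j)"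
  shows "multilinear_fun (\<Union>j\<in>J. A j) (card J * d) (\<lambda>y. \<Prod>j\<in>J. F j y)"
  using assms
proof (induction J rule: finite_induct)
  case empty
  show ?case using multilinear_fun_monomial[of "{}" "{}" 0 1] by simp
next
  case (insert j J)
  have "multilinear_fun (A j \<union> (\<Union>j\<in>J. A j)) (d + card J * d) (\<lambda>y. F j y * (\<Prod>j\<in>J. F j y))"
    using insert
    by (intro multilinear_fun_mult) (auto simp: disjoint_family_on_def)
  then show ?case using insert.hyps by simp
qed

text \<open>The way back from functions to coefficient families, the form that
  \<open>represents\<close> asks for. A derivation may use the same index set several times; its
  coefficients are then added up.\<close>

lemma multilinear_fun_coeffs:
  assumes "multilinear_fun A d F" "finite A"
  obtains c where "\<And>S. c S \<noteq> 0 \<Longrightarrow> S \<subseteq> A \<and> card S \<le> d"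
    and "\<And>y. F y = (\<Sum>S\<in>Pow A. c S * (\<Prod>i\<in>S. y i))"
proof -
  from assms(1) have "\<exists>c. (\<forall>S. c S \<noteq> 0 \<longrightarrow> S \<subseteq> A \<and> card S \<le> d) \<and>
      (\<forall>y. F y = (\<Sum>S\<in>Pow A. c S * (\<Prod>i\<in>S. y i)))"
  proof induction
    case zero
    show ?case by (rule exI[of _ "\<lambda>_. 0"]) simp
  next
    case (add_monomial T F a)
    then obtain c where c: "\<And>S. c S \<noteq> 0 \<Longrightarrow> S \<subseteq> A \<and> card S \<le> d"
      "\<And>y. F y = (\<Sum>S\<in>Pow A. c S * (\<Prod>i\<in>S. y i))" by blast
    have "a * (\<Prod>i\<in>T. y i) = (\<Sum>S\<in>Pow A. (if S = T then a else 0) * (\<Prod>i\<in>S. y i))" for y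
      using add_monomial.hyps(1) assms(2)
      by (simp add: if_distrib[of "\<lambda>u. u * _"] cong: if_cong)
    then show ?case
      using c add_monomial.hyps(1,2)
      by (intro exI[of _ "\<lambda>S. (if S = T then a else 0) + c S"])
        (auto simp: distrib_right sum.distrib split: if_splits)
  qed
  then show ?thesis using that by blast
qed

section \<open>The not-all-equal polynomial and its iterates\<close>

definition not_all_equal :: "nat \<Rightarrow> (nat \<Rightarrow> real) \<Rightarrow> real" where
  "not_all_equal N v = 1 - (\<Prod>j<N. v j) - (\<Prod>j<N. 1 - v j)"

text \<open>Expanding \<open>\<Prod>j<N. 1 - v j\<close> over subsets, the full set contributes
  \<open>- (\<Prod>j<N. v j)\<close> for odd \<open>N\<close>, which cancels the other top monomial.
  Only proper subsets remain.\<close>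

lemma not_all_equal_expand:
  assumes "odd N"
  shows "not_all_equal N v =
    1 + (\<Sum>S\<in>Pow {..<N} - {{..<N}}. - ((-1) ^ card S) * (\<Prod>j\<in>S. v j))"
proof -
  have "(\<Prod>j<N. 1 - v j) = (\<Prod>j<N. - v j + 1)" by simp
  also have "\<dots> = (\<Sum>S\<in>Pow {..<N}. (\<Prod>j\<in>S. - v j) * (\<Prod>j\<in>{..<N} - S. 1))"
    by (rule prod_add) simp
  also have "\<dots> = (\<Sum>S\<in>Pow {..<N}. (-1) ^ card S * (\<Prod>j\<in>S. v j))"
    by (simp add: prod_uminus)
  also have "\<dots> = - (\<Prod>j<N. v j) +
      (\<Sum>S\<in>Pow {..<N} - {{..<N}}. (-1) ^ card S * (\<Prod>j\<in>S. v j))"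
    using assms by (subst sum.remove[of _ "{..<N}"]) auto
  finally show ?thesis by (simp add: not_all_equal_def sum_negf)
qed

text \<open>The offset \<open>s\<close> lets the \<open>N\<close> copies read consecutive disjoint
  blocks of length \<open>N ^ m\<close> without renaming variables; inductions on \<open>m\<close>
  therefore generalize over \<open>s\<close>.\<close>

fun iter_nae :: "nat \<Rightarrow> nat \<Rightarrow> nat \<Rightarrow> (nat \<Rightarrow> real) \<Rightarrow> real" where
  "iter_nae N 0 s y = y s"
| "iter_nae N (Suc m) s y = not_all_equal N (\<lambda>j. iter_nae N m (s + j * N ^ m) y)"

definition block :: "nat \<Rightarrow> nat \<Rightarrow> nat \<Rightarrow> nat set" where
  "block N m s = {s..<s + N ^ m}"

lemma block_sub:
  assumes "j < N"
  shows "block N m (s + j * N ^ m) \<subseteq> block N (Suc m) s"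
proof -
  have "Suc j * N ^ m \<le> N * N ^ m" using assms by (intro mult_right_mono) auto
  then show ?thesis by (auto simp: block_def)
qed

lemma block_disjoint: "disjoint_family (\<lambda>j. block N m (s + j * N ^ m))"
proof -
  have "block N m (s + i * N ^ m) \<inter> block N m (s + j * N ^ m) = {}" if "i < j" for i j
  proof -
    have "Suc i * N ^ m \<le> j * N ^ m" using that by (intro mult_right_mono) auto
    then show ?thesis by (auto simp: block_def)
  qed
  then show ?thesis
    unfolding disjoint_family_on_def by (metis Int_commute linorder_neqE_nat)
qed

lemma block_Suc: "block N (Suc m) s = (\<Union>j<N. block N m (s + j * N ^ m))"
proof
  show "block N (Suc m) s \<subseteq> (\<Union>j<N. block N m (s + j * N ^ m))"
  proof
    fix i assume i: "i \<in> block N (Suc m) s"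
    \<comment> \<open>For \<open>N = 0\<close> the block on level \<open>Suc m\<close> is empty and
      cannot contain \<open>i\<close>.\<close>
    then have "N ^ m > 0" by (cases "N = 0") (auto simp: block_def)
    have "(i - s) div N ^ m < N"
      using i by (auto simp: block_def less_mult_imp_div_less)
    moreover have "i \<in> block N m (s + (i - s) div N ^ m * N ^ m)"
      using i div_mult_mod_eq[of "i - s" "N ^ m"] mod_less_divisor[OF \<open>N ^ m > 0\<close>, of "i - s"]
      by (auto simp: block_def)
    ultimately show "i \<in> (\<Union>j<N. block N m (s + j * N ^ m))" by blast
  qed
qed (use block_sub in blast)

text \<open>Each term of the expansion multiplies the iterates on at most \<open>K\<close> of the
  \<open>K + 1\<close> disjoint blocks, each of degree at most \<open>K ^ m\<close>.\<close>

lemma multilinear_iter_nae: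
  assumes "even K"
  shows "multilinear_fun (block (Suc K) m s) (K ^ m) (iter_nae (Suc K) m s)"
proof (induction m arbitrary: s)
  case 0
  show ?case
    using multilinear_fun_monomial[of "{s}" "block (Suc K) 0 s" 1 1] by (simp add: block_def)
next
  case (Suc m)
  let ?N = "Suc K"
  let ?B = "\<lambda>j. block ?N m (s + j * ?N ^ m)"
  let ?F = "\<lambda>j. iter_nae ?N m (s + j * ?N ^ m)"
  have "multilinear_fun (block ?N (Suc m) s) (K ^ Suc m) (\<lambda>y. \<Prod>j\<in>S. ?F j y)"
    if S: "S \<in> Pow {..<?N} - {{..<?N}}" for S
  proof (rule multilinear_fun_mono)
    show "multilinear_fun (\<Union>j\<in>S. ?B j) (card S * K ^ m) (\<lambda>y. \<Prod>j\<in>S. ?F j y)"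
    proof (rule multilinear_fun_prod)
      show "finite S" using S by (auto intro: finite_subset)
      show "disjoint_family_on ?B S"
        using block_disjoint[of ?N m s] by (auto simp: disjoint_family_on_def)
      show "finite (?B j)" for j by (simp add: block_def)
    qed (rule Suc.IH)
    show "(\<Union>j\<in>S. ?B j) \<subseteq> block ?N (Suc m) s" using S unfolding block_Suc by blast
    have "card S < card {..<?N}" using S by (intro psubset_card_mono) auto
    then show "card S * K ^ m \<le> K ^ Suc m" by simp
  qed
  \<comment> \<open>The constant 1 is written as the monomial of the empty set, to fit
    \<open>add_monomial\<close>.\<close>
  then have "multilinear_fun (block ?N (Suc m) s) (K ^ Suc m) (\<lambda>y. 1 * (\<Prod>i\<in>{}. y i) +
      (\<Sum>S\<in>Pow {..<?N} - {{..<?N}}. - ((-1) ^ card S) * (\<Prod>j\<in>S. ?F j y)))"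
    by (intro multilinear_fun.add_monomial multilinear_fun_sum multilinear_fun_scale) auto
  moreover have "iter_nae ?N (Suc m) s = (\<lambda>y. 1 * (\<Prod>i\<in>{}. y i) +
      (\<Sum>S\<in>Pow {..<?N} - {{..<?N}}. - ((-1) ^ card S) * (\<Prod>j\<in>S. ?F j y)))"
    using assms by (intro ext) (simp add: not_all_equal_expand)
  ultimately show ?case by simp
qed

section \<open>Restriction to the diagonal and its exact degree\<close>

definition diag_nae :: "nat \<Rightarrow> real poly" where
  "diag_nae N = 1 - monom 1 N - [:1, -1:] ^ N"

text \<open>On a constant input all blocks take the same value, so nesting becomes composition of
  univariate polynomials and the offset does not matter.\<close>

lemma poly_iter_diag_nae:
  "poly (((\<circ>\<^sub>p) (diag_nae N) ^^ m) [:0, 1:]) t = iter_nae N m s (\<lambda>_. t)"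
  by (induction m arbitrary: s)
    (simp_all add: poly_pcompose diag_nae_def not_all_equal_def poly_monom)

text \<open>For even \<open>K\<close> the coefficient at \<open>K + 1\<close> is -1 + 1 = 0, and the
  one at \<open>K\<close> is \<open>-(K + 1)\<close>, which is nonzero.\<close>

lemma degree_diag_nae:
  assumes "even K" "K > 0"
  shows "degree (diag_nae (Suc K)) = K"
proof (rule antisym)
  have *: "coeff (diag_nae (Suc K)) i = (if i = 0 then 1 else 0) - (if i = Suc K then 1 else 0)
      - of_nat (Suc K choose i) * (-1) ^ i" for i
  proof -
    have "coeff ([:1, -1:] ^ Suc K) i = real (Suc K choose i) * (-1) ^ i"
    proof (cases "i \<le> Suc K")
      case True
      then show ?thesis by (simp add: coeff_linear_poly_power del: power_Suc)
    next
      case False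
      then have "degree ([:1, -1 :: real:] ^ Suc K) < i"
        using degree_power_le[of "[:1, -1 :: real:]" "Suc K"] by simp
      then show ?thesis using False by (simp add: coeff_eq_0 del: power_Suc)
    qed
    then show ?thesis by (auto simp: diag_nae_def simp del: power_Suc)
  qed
  show "degree (diag_nae (Suc K)) \<le> K"
  proof (rule degree_le, intro allI impI)
    fix i assume "K < i"
    then consider "i = Suc K" | "i > Suc K" by linarith
    then show "coeff (diag_nae (Suc K)) i = 0"
      by cases (use assms in \<open>simp_all add: *\<close>)
  qed
  show "K \<le> degree (diag_nae (Suc K))"
    by (rule le_degree) (use assms in \<open>simp add: *\<close>)
qed

lemma degree_iter_diag_nae:
  assumes "even K" "K > 0"
  shows "degree (((\<circ>\<^sub>p) (diag_nae (Suc K)) ^^ m) [:0, 1:]) = K ^ m"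
  by (induction m) (simp_all add: degree_pcompose degree_diag_nae[OF assms])

text \<open>On the diagonal the monomial of \<open>S\<close> becomes a power of exponent
  \<open>card S\<close>. Cancellation between sets can only lower the degree, so the univariate
  degree bounds the multilinear one from below.\<close>

lemma degree_diagonal_le:
  fixes c :: "nat set \<Rightarrow> real"
  assumes "\<And>S. c S \<noteq> 0 \<Longrightarrow> card S \<le> d"
    and "\<And>t. poly p t = (\<Sum>S\<in>P. c S * (\<Prod>i\<in>S. t))"
  shows "degree p \<le> d"
proof -
  have "p = (\<Sum>S\<in>P. monom (c S) (card S))"
    by (rule poly_ext) (simp add: assms(2) poly_sum poly_monom)
  moreover have "degree (\<Sum>S\<in>P. monom (c S) (card S)) \<le> d"
  proof (cases "finite P")
    case True
    have "degree (monom (c S) (card S)) \<le> d" for S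
      using assms(1)[of S] by (cases "c S = 0") (auto simp: degree_monom_eq)
    then show ?thesis using True by (intro degree_sum_le)
  qed simp
  ultimately show ?thesis by simp
qed

section \<open>Boolean values and sensitivity at the origin\<close>

lemma not_all_equal_Boolean:
  assumes "\<And>j. j < N \<Longrightarrow> v j \<in> {0, 1}" "N > 0"
  shows "not_all_equal N v = of_bool (\<not> (\<forall>j<N. v j = 0) \<and> \<not> (\<forall>j<N. v j = 1))"
proof -
  have "(\<Prod>j<N. v j) = of_bool (\<forall>j<N. v j = 1)"
    using assms by (auto intro!: prod.neutral bexI)
  moreover have "(\<Prod>j<N. 1 - v j) = of_bool (\<forall>j<N. v j = 0)"
    using assms by (auto intro!: prod.neutral)
  \<comment> \<open>For \<open>N = 0\<close> both conditions would hold at once and the value would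
    be -1; \<open>N > 0\<close> excludes this.\<close>
  ultimately show ?thesis
    using assms(2) by (auto simp: not_all_equal_def)
qed

lemma iter_nae_Boolean:
  assumes "N > 0" "\<And>i. i \<in> block N m s \<Longrightarrow> y i \<in> {0, 1}"
  shows "iter_nae N m s y \<in> {0, 1}"
  using assms(2)
proof (induction m arbitrary: s)
  case 0
  then show ?case by (simp add: block_def)
next
  case (Suc m)
  have "iter_nae N m (s + j * N ^ m) y \<in> {0, 1}" if "j < N" for j
    using Suc block_sub[OF that] by blast
  then show ?case using assms(1) by (simp add: not_all_equal_Boolean) blast
qed

text \<open>At most \<open>K\<close> ones cannot reach all \<open>K + 1\<close> disjoint subblocks,
  so the all-ones case never occurs at any level and not-all-equal acts as a disjunction.\<close>

lemma iter_nae_sensitive: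
  assumes "finite S" "card (S \<inter> block (Suc K) m s) \<le> K"
    and "\<And>i. i \<in> block (Suc K) m s \<Longrightarrow> y i = of_bool (i \<in> S)"
  shows "iter_nae (Suc K) m s y = of_bool (S \<inter> block (Suc K) m s \<noteq> {})"
  using assms(2,3)
proof (induction m arbitrary: s)
  case 0
  then show ?case by (simp add: block_def)
next
  case (Suc m)
  let ?N = "Suc K"
  let ?B = "\<lambda>j. block ?N m (s + j * ?N ^ m)"
  let ?v = "\<lambda>j. iter_nae ?N m (s + j * ?N ^ m) y"
  have v: "?v j = of_bool (S \<inter> ?B j \<noteq> {})" if "j < ?N" for j
  proof (rule Suc.IH)
    note sub = block_sub[OF that, of m s]
    have "card (S \<inter> ?B j) \<le> card (S \<inter> block ?N (Suc m) s)"
      using sub assms(1) by (intro card_mono) auto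
    then show "card (S \<inter> ?B j) \<le> K" using Suc.prems(1) by simp
    show "y i = of_bool (i \<in> S)" if "i \<in> ?B j" for i
      using Suc.prems(2) that sub by blast
  qed
  have "\<not> (\<forall>j<?N. S \<inter> ?B j \<noteq> {})"
  proof
    assume hit: "\<forall>j<?N. S \<inter> ?B j \<noteq> {}"
    have "?N = (\<Sum>j<?N. 1)" by simp
    also have "\<dots> \<le> (\<Sum>j<?N. card (S \<inter> ?B j))"
      using hit assms(1) by (intro sum_mono) (simp add: Suc_le_eq card_gt_0_iff)
    also have "\<dots> = card (\<Union>j<?N. S \<inter> ?B j)"
      using assms(1) block_disjoint[of ?N m s]
      by (intro card_UN_disjoint[symmetric]) (auto simp: disjoint_family_on_def)
    also have "(\<Union>j<?N. S \<inter> ?B j) = S \<inter> block ?N (Suc m) s"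
      unfolding block_Suc by blast
    finally show False using Suc.prems(1) by simp
  qed
  moreover have "iter_nae ?N (Suc m) s y =
      of_bool (\<not> (\<forall>j<?N. ?v j = 0) \<and> \<not> (\<forall>j<?N. ?v j = 1))"
    unfolding iter_nae.simps by (rule not_all_equal_Boolean) (auto simp: v)
  ultimately show ?case
    unfolding block_Suc by (auto simp: v)
qed

section \<open>The iterated Boolean function and the infinite family\<close>

lemma iter_nae_function:
  assumes "even K" "K > 0"
  defines "f \<equiv> \<lambda>m x. iter_nae (Suc K) m 1 (\<lambda>i. of_bool (x i)) = 1"
  shows "order_sensitive K (Suc K ^ m) (f m)" and "pdeg (Suc K ^ m) (f m) = K ^ m"
proof -
  let ?N = "Suc K"
  let ?n = "?N ^ m"
  have B: "block ?N m 1 = {1..?n}" by (auto simp: block_def)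
  \<comment> \<open>Used twice below: for the origin flipped in \<open>S\<close>, and with the empty
    set for the origin itself.\<close>
  have f: "f m x \<longleftrightarrow> S \<inter> {1..?n} \<noteq> {}"
    if "finite S" "card S \<le> K" "\<And>i. i \<in> {1..?n} \<Longrightarrow> x i = (i \<in> S)" for x S
  proof -
    have "card (S \<inter> {1..?n}) \<le> K"
      using that(1,2) card_mono[of S "S \<inter> {1..?n}"] by auto
    then have "iter_nae ?N m 1 (\<lambda>i. of_bool (x i)) = of_bool (S \<inter> {1..?n} \<noteq> {})"
      using that by (intro iter_nae_sensitive[of S K m 1, unfolded B]) auto
    then show ?thesis by (simp add: f_def)
  qed
  show "order_sensitive K ?n (f m)"
    unfolding order_sensitive_def
  proof (intro bexI allI impI)
    let ?x = "restrict (\<lambda>_. False) {1..?n}"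
    show "?x \<in> cube ?n" by (simp add: cube_def)
    fix S assume S: "S \<subseteq> {1..?n} \<and> 1 \<le> card S \<and> card S \<le> K"
    have "f m (flip S ?x)"
      using S f[of S "flip S ?x"] by (auto simp: flip_def card_ge_0_finite Int_absorb2)
    moreover have "\<not> f m ?x" using f[of "{}" ?x] by simp
    ultimately show "f m ?x \<noteq> f m (flip S ?x)" by simp
  qed
  obtain c where c: "\<And>S. c S \<noteq> 0 \<Longrightarrow> S \<subseteq> {1..?n} \<and> card S \<le> K ^ m"
    "\<And>y. iter_nae ?N m 1 y = (\<Sum>S\<in>Pow {1..?n}. c S * (\<Prod>i\<in>S. y i))"
    using multilinear_fun_coeffs[OF multilinear_iter_nae[OF assms(1), of m 1]] unfolding B by auto
  \<comment> \<open>The iterate takes only the values 0 and 1 on Boolean inputs, so testing for 1 in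
    \<open>f\<close> loses no information.\<close>
  have "ml_eval ?n c (\<lambda>i. of_bool (x i)) = of_bool (f m x)" for x
    using iter_nae_Boolean[of ?N m 1 "\<lambda>i. of_bool (x i)"]
    unfolding ml_eval_def c(2)[symmetric] by (auto simp: f_def)
  then have "represents ?n c (f m)"
    using c(1) by (simp add: represents_def multilinear_def)
  then have pdeg: "pdeg ?n (f m) = ml_degree c"
    unfolding pdeg_def by (simp add: the1_equality[OF represents_ex1])
  have "{S. c S \<noteq> 0} \<subseteq> Pow {1..?n}" using c(1) by blast
  then have fin: "finite {S. c S \<noteq> 0}" by (rule finite_subset) simp
  \<comment> \<open>The diagonal of the polynomial with coefficients \<open>c\<close> is the iterate
    of \<open>diag_nae\<close>, whose degree is known exactly.\<close>
  have "K ^ m \<le> ml_degree c"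
    unfolding degree_iter_diag_nae[OF assms(1,2), of m, symmetric]
  proof (rule degree_diagonal_le)
    show "card S \<le> ml_degree c" if "c S \<noteq> 0" for S
      unfolding ml_degree_def using that fin by (intro Max_ge) auto
  qed (simp only: poly_iter_diag_nae[of _ _ _ 1] c(2))
  moreover have "ml_degree c \<le> K ^ m"
    unfolding ml_degree_def using c(1) fin by (intro Max.boundedI) auto
  ultimately show "pdeg ?n (f m) = K ^ m" using pdeg by simp
qed

lemma order_sensitive_mono: "order_sensitive K n f \<Longrightarrow> k \<le> K \<Longrightarrow> order_sensitive k n f"
  unfolding order_sensitive_def by (meson le_trans)

lemma infinite_sensitive_low_degree:
  assumes "even K" "K > 0" "k \<le> K"
  shows "infinite {n. \<exists>f. order_sensitive k n f \<and>
    real (pdeg n f) = real n powr (ln (real K) / ln (real (K + 1)))}"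
    (is "infinite ?X")
proof -
  have "Suc K ^ m \<in> ?X" for m
  proof -
    \<comment> \<open>The logarithm of the base is \<open>m * ln (K + 1)\<close>; its nonzero factor
      \<open>ln (K + 1)\<close> cancels the denominator of the exponent.\<close>
    have "real (Suc K ^ m) powr (ln (real K) / ln (real (K + 1))) = exp (real m * ln (real K))"
      using assms(2) by (simp add: powr_def ln_realpow)
    also have "\<dots> = real (K ^ m)"
      using assms(2) by (simp add: exp_of_nat_mult)
    finally show ?thesis
      using iter_nae_function[OF assms(1,2), of m] order_sensitive_mono[OF _ assms(3)] by auto
  qed
  then have "range ((^) (Suc K)) \<subseteq> ?X" by blast
  moreover have "inj ((^) (Suc K))" using assms(2) by (intro injI) simp
  ultimately show ?thesis
    using range_inj_infinite infinite_super by blast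
qed

theorem mainTheorem9:
  fixes k :: nat
  assumes "k \<ge> 1"
  shows "infinite {n :: nat. \<exists>f :: (nat \<Rightarrow> bool) \<Rightarrow> bool. order_sensitive k n f \<and>
           real (pdeg n f) =
             (if even k then real n powr (ln (real k) / ln (real (k + 1)))
              else real n powr (ln (real (k + 1)) / ln (real (k + 2))))}"
proof (cases "even k")
  case True
  then show ?thesis using assms infinite_sensitive_low_degree[of k k] by simp
next
  case False
  then show ?thesis using infinite_sensitive_low_degree[of "k + 1" k] by simp
qed

end
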